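(* Let $F$ be a field. Let $A_0(t)\in F[[t]]$ be a formal power series with nonzero constant term, and for each $k\ge 1$ let $\Delta_k(t), A_k(t)\in F[[t]]$ be formal power series with zero constant term. Consider the continued fraction $$f(t)\;=\;\cfrac{A_0(t)}{1-\Delta_1(t)-\cfrac{A_1(t)}{1-\Delta_2(t)-\cfrac{A_2(t)}{1-\cdots}}}$$ and, for $k\ge 0$, set $$f_k(t)\;=\;\cfrac{1}{1-\Delta_{k+1}(t)-\cfrac{A_{k+1}(t)}{1-\Delta_{k+2}(t)-\cfrac{A_{k+2}(t)}{1-\cdots}}}\,.$$ Let $g_{-1}(t)\in F[[t]]$ be any formal power series with constant term $1$, and for $k\ge 0$ set $g_k(t)=g_{-1}(t)\prod_{i=0}^{k} f_i(t)$. Then $f(t)$ equals $A_0(t)$ times the generating function for Motzkin paths at level $0$ in which each rise gets weight $1$, each fall starting at height $i$ gets weight $A_i(t)$, and each level step at height $i$ gets weight $\Delta_{i+1}(t)$. Moreover, for every $k\ge 0$, $f_k(t)$ is the generating function for Motzkin paths at level $k$ with these weights, and $g_k(t)$ is $g_{-1}(t)$ times the generating function for Motzkin paths at level $0\to k$ with these weights.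
   Context: Infinite continued fractions are understood as formal power series in $t$: since all $\Delta_k$ and $A_k$ with $k\ge1$ have zero constant term, the truncations of the continued fraction at successive levels are well-defined elements of $F[[t]]$ and converge in the $t$-adic (coefficientwise) topology. Lattice paths use the steps $(1,1)$ (a "rise"), $(1,0)$ (a "level step") and $(1,-1)$ (a "fall"). The height of a point is its second coordinate. For $k,\ell\ge0$, a Motzkin path at level $k\to\ell$ is a finite path (possibly of length $0$) in $\mathbb{Z}\times\mathbb{N}$ (with $\mathbb{N}=\{0,1,2,\ldots\}$) using these steps, starting at $(0,k)$, ending at height $\ell$, and staying always at height $\ge\min(k,\ell)$. A Motzkin path at level $k$ is a Motzkin path at level $k\to k$. The weight of a path is the product of the weights of its steps (the empty path has weight $1$), and the generating function of a class of paths is the sum of the weights of all paths in the class. These sums converge in $F[[t]]$ in the $t$-adic topology because the weights of falls and level steps have zero constant term. *)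

theory Defs
  imports "HOL-Computational_Algebra.Formal_Power_Series" "HOL-Analysis.Infinite_Sum"
begin

text \<open>
  All limits and infinite sums in \<^typ>\<open>'a fps\<close> below refer to the library's metric on formal
  power series, that is, to the \<open>t\<close>-adic topology.

  The coefficient sequences are \<open>A\<^sub>0, A\<^sub>1, \<dots>\<close> and \<open>D\<^sub>1, D\<^sub>2, \<dots>\<close> (the latter being the Deltas);
  the value \<open>D 0\<close> is never used.
\<close>

text \<open>
  Denominators of the truncated continued fraction starting at level \<open>k\<close>:
  \<open>cf_denom D A n k\<close> is
  \<open>1 - D\<^bsub>k+1\<^esub> - A\<^bsub>k+1\<^esub> / (1 - D\<^bsub>k+2\<^esub> - A\<^bsub>k+2\<^esub> / (\<dots> / (1 - D\<^bsub>k+n+1\<^esub>)\<dots>))\<close>.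
\<close>

fun cf_denom :: "(nat \<Rightarrow> 'a::field fps) \<Rightarrow> (nat \<Rightarrow> 'a fps) \<Rightarrow> nat \<Rightarrow> nat \<Rightarrow> 'a fps" where
  "cf_denom D A 0 k = 1 - D (k + 1)"
| "cf_denom D A (Suc n) k = 1 - D (k + 1) - A (k + 1) / cf_denom D A n (k + 1)"

definition cf_full :: "(nat \<Rightarrow> 'a::field fps) \<Rightarrow> (nat \<Rightarrow> 'a fps) \<Rightarrow> 'a fps" where
  "cf_full D A = lim (\<lambda>n. A 0 / cf_denom D A n 0)"

definition cf_tail :: "(nat \<Rightarrow> 'a::field fps) \<Rightarrow> (nat \<Rightarrow> 'a fps) \<Rightarrow> nat \<Rightarrow> 'a fps" where
  "cf_tail D A k = lim (\<lambda>n. 1 / cf_denom D A n k)"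

datatype step = Rise | Level | Fall

fun step_dy :: "step \<Rightarrow> int" where
  "step_dy Rise = 1"
| "step_dy Level = 0"
| "step_dy Fall = -1"

text \<open>
  Every step has horizontal displacement 1, so a path starting at \<open>(0, k)\<close> is encoded by its
  list of steps; its vertices are the points \<open>(i, height k p i)\<close> for \<open>i \<le> length p\<close>.
\<close>

definition height :: "nat \<Rightarrow> step list \<Rightarrow> nat \<Rightarrow> int" where
  "height k p i = int k + (\<Sum>s\<leftarrow>take i p. step_dy s)"

definition motzkin_paths :: "nat \<Rightarrow> nat \<Rightarrow> step list set" where
  "motzkin_paths k l =
     {p. height k p (length p) = int l \<and> (\<forall>i\<le>length p. height k p i \<ge> int (min k l))}"

fun step_weight :: "(nat \<Rightarrow> 'a::field fps) \<Rightarrow> (nat \<Rightarrow> 'a fps) \<Rightarrow> step \<Rightarrow> nat \<Rightarrow> 'a fps" where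
  "step_weight D A Rise i = 1"
| "step_weight D A Level i = D (i + 1)"
| "step_weight D A Fall i = A i"

text \<open>
  The conversion \<open>nat\<close> is harmless: vertices of Motzkin paths have nonnegative heights.
\<close>

definition path_weight ::
  "(nat \<Rightarrow> 'a::field fps) \<Rightarrow> (nat \<Rightarrow> 'a fps) \<Rightarrow> nat \<Rightarrow> step list \<Rightarrow> 'a fps" where
  "path_weight D A k p = (\<Prod>i<length p. step_weight D A (p ! i) (nat (height k p i)))"

definition motzkin_gf ::
  "(nat \<Rightarrow> 'a::field fps) \<Rightarrow> (nat \<Rightarrow> 'a fps) \<Rightarrow> nat \<Rightarrow> nat \<Rightarrow> 'a fps" where
  "motzkin_gf D A k l = (\<Sum>\<^sub>\<infinity>p\<in>motzkin_paths k l. path_weight D A k p)"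

end

theory Submission
  imports Defs
begin

text \<open>
  Write \<open>M\<^sub>k\<close> for the generating function of the Motzkin paths at level \<open>k\<close>. Two unique
  decompositions of paths carry the proof.

  A path at level \<open>b \<rightarrow> m + 1\<close> with \<open>b \<le> m\<close> has a last visit to height \<open>m\<close>. It leaves that height
  by a rise and stays at height \<open>\<ge> m + 1\<close> ever after, so it is a path at level \<open>b \<rightarrow> m\<close>, a rise, and
  a Motzkin path at level \<open>m + 1\<close> (\<open>last_passage_bij\<close>). Rises have weight \<open>1\<close>, hence the generating
  functions multiply (\<open>motzkin_gf_Suc\<close>). Iterating from \<open>b = 0\<close> shows that the generating function
  for level \<open>0 \<rightarrow> k\<close> is \<open>M\<^sub>0 M\<^sub>1 \<dots> M\<^sub>k\<close>, which gives the claim on \<open>g\<^sub>k\<close> once \<open>f\<^sub>i = M\<^sub>i\<close> is known.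

  A nonempty Motzkin path at level \<open>k\<close> ends with a level step or with a fall from height \<open>k + 1\<close>;
  in the latter case what precedes the fall is a path at level \<open>k \<rightarrow> k + 1\<close>, counted by
  \<open>M\<^sub>k M\<^bsub>k+1\<^esub>\<close>. Hence \<open>M\<^sub>k (1 - D\<^bsub>k+1\<^esub> - A\<^bsub>k+1\<^esub> M\<^bsub>k+1\<^esub>) = 1\<close>
  (\<open>motzkin_gf_continued_fraction_step\<close>), which is the recurrence that the tails of the continued
  fraction satisfy formally. It holds for all \<open>k\<close> at once and so has no initial value, but each use
  of it multiplies an error by \<open>A\<^bsub>k+1\<^esub>\<close>, which is divisible by \<open>t\<close>. Therefore the \<open>n\<close>-th
  truncation of the continued fraction agrees with \<open>M\<^sub>k\<close> modulo \<open>t\<^bsup>n+1\<^esup>\<close>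
  (\<open>X_power_dvd_motzkin_gf_minus_convergent\<close>), which yields convergence and the value of the limit.

  All sums converge because a path with given endpoints and \<open>d\<close> falls and level steps has bounded
  length, while its weight is divisible by \<open>t\<^bsup>d\<^esup>\<close> (\<open>path_weight_summable\<close>).
\<close>

section \<open>Sums of families of formal power series\<close>

lemma has_sum_fps_nth:
  fixes F :: "'b \<Rightarrow> 'a::ab_group_add fps"
  assumes "(F has_sum S) I" "finite B" "B \<subseteq> I" "\<And>x. x \<in> I - B \<Longrightarrow> fps_nth (F x) n = 0"
  shows "fps_nth S n = (\<Sum>x\<in>B. fps_nth (F x) n)"
  unfolding has_sum_fpsD(2)[OF assms(1)]
  by (rule sum.mono_neutral_left) (use assms in auto)

text \<open>
  The library criterion requires the exact support of each coefficient. For a product of two families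
  only a finite superset of it is at hand, and this form accepts any such superset.
\<close>

lemma has_sum_fps_witnessI:
  fixes F :: "'b \<Rightarrow> 'a::ab_group_add fps"
  assumes "\<And>n. finite (B n)" "\<And>n. B n \<subseteq> I"
    and "\<And>n x. x \<in> I - B n \<Longrightarrow> fps_nth (F x) n = 0"
    and "\<And>n. fps_nth S n = (\<Sum>x\<in>B n. fps_nth (F x) n)"
  shows "(F has_sum S) I"
proof (rule has_sum_fpsI)
  fix n
  have sub: "{x\<in>I. fps_nth (F x) n \<noteq> 0} \<subseteq> B n" using assms(3) by blast
  then show "finite {x\<in>I. fps_nth (F x) n \<noteq> 0}" using assms(1) finite_subset by blast
  show "fps_nth S n = (\<Sum>x | x \<in> I \<and> fps_nth (F x) n \<noteq> 0. fps_nth (F x) n)"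
    unfolding assms(4) by (rule sum.mono_neutral_right) (use assms sub in auto)
qed

lemma has_sum_fps_Un_disjoint:
  fixes F :: "'b \<Rightarrow> 'a::ab_group_add fps"
  assumes S: "(F has_sum S) I" and T: "(F has_sum T) J" and disj: "I \<inter> J = {}"
  shows "(F has_sum (S + T)) (I \<union> J)"
proof -
  define supp where "supp K n = {x\<in>K. fps_nth (F x) n \<noteq> 0}" for K n
  note fin = has_sum_fpsD(1)[OF S, folded supp_def] has_sum_fpsD(1)[OF T, folded supp_def]
  show ?thesis
  proof (rule has_sum_fps_witnessI[where B = "\<lambda>n. supp I n \<union> supp J n"])
    fix n
    have "supp I n \<inter> supp J n = {}" using disj by (auto simp: supp_def)
    then show "fps_nth (S + T) n = (\<Sum>x\<in>supp I n \<union> supp J n. fps_nth (F x) n)"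
      using has_sum_fpsD(2)[OF S, of n] has_sum_fpsD(2)[OF T, of n] fin
      by (simp add: sum.union_disjoint supp_def)
  qed (use fin in \<open>auto simp: supp_def\<close>)
qed

text \<open>
  The coefficient of \<open>t\<^sup>n\<close> in a product depends only on the coefficients of order at most \<open>n\<close> in the
  factors, and these vanish for all but finitely many members of each family.
\<close>

lemma has_sum_fps_Times:
  fixes F :: "'b \<Rightarrow> 'a::comm_ring_1 fps" and G :: "'c \<Rightarrow> 'a fps"
  assumes S: "(F has_sum S) I" and T: "(G has_sum T) J"
  shows "((\<lambda>(x, y). F x * G y) has_sum (S * T)) (I \<times> J)"
proof -
  define X where "X n = (\<Union>i\<le>n. {x\<in>I. fps_nth (F x) i \<noteq> 0})" for n
  define Y where "Y n = (\<Union>i\<le>n. {y\<in>J. fps_nth (G y) i \<noteq> 0})" for n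
  have fin: "finite (X n)" "finite (Y n)" for n
    using has_sum_fpsD(1)[OF S] has_sum_fpsD(1)[OF T] by (auto simp: X_def Y_def)
  have sub: "X n \<subseteq> I" "Y n \<subseteq> J" for n by (auto simp: X_def Y_def)
  have zero: "x \<in> I - X n \<Longrightarrow> i \<le> n \<Longrightarrow> fps_nth (F x) i = 0"
    "y \<in> J - Y n \<Longrightarrow> i \<le> n \<Longrightarrow> fps_nth (G y) i = 0" for n i x y
    by (auto simp: X_def Y_def)
  show ?thesis
  proof (rule has_sum_fps_witnessI[where B = "\<lambda>n. X n \<times> Y n"])
    fix n z
    assume "z \<in> I \<times> J - X n \<times> Y n"
    then show "fps_nth (case z of (x, y) \<Rightarrow> F x * G y) n = 0"
      using zero by (auto simp: fps_mult_nth intro!: sum.neutral)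
  next
    fix n
    have "fps_nth (S * T) n = (\<Sum>i\<le>n. fps_nth S i * fps_nth T (n - i))"
      by (simp add: fps_mult_nth atMost_atLeast0)
    also have "\<dots> = (\<Sum>i\<le>n. (\<Sum>x\<in>X n. fps_nth (F x) i) * (\<Sum>y\<in>Y n. fps_nth (G y) (n - i)))"
      by (intro sum.cong refl arg_cong2[where f = "(*)"]
          has_sum_fps_nth[OF S] has_sum_fps_nth[OF T] fin sub) (auto intro: zero)
    also have "\<dots> = (\<Sum>i\<le>n. \<Sum>z\<in>X n \<times> Y n. fps_nth (F (fst z)) i * fps_nth (G (snd z)) (n - i))"
      by (simp add: sum_product sum.cartesian_product case_prod_beta)
    also have "\<dots> = (\<Sum>z\<in>X n \<times> Y n. \<Sum>i\<le>n. fps_nth (F (fst z)) i * fps_nth (G (snd z)) (n - i))"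
      by (rule sum.swap)
    also have "\<dots> = (\<Sum>z\<in>X n \<times> Y n. fps_nth (case z of (x, y) \<Rightarrow> F x * G y) n)"
      by (simp add: fps_mult_nth atMost_atLeast0 case_prod_beta)
    finally show "fps_nth (S * T) n = (\<Sum>z\<in>X n \<times> Y n. fps_nth (case z of (x, y) \<Rightarrow> F x * G y) n)" .
  qed (use fin sub in \<open>auto dest: subsetD[OF sub(1)] subsetD[OF sub(2)]\<close>)
qed

lemma has_sum_fps_mult_right:
  fixes F :: "'b \<Rightarrow> 'a::comm_ring_1 fps"
  assumes S: "(F has_sum S) I"
  shows "((\<lambda>x. F x * c) has_sum (S * c)) I"
proof -
  have "((\<lambda>_. c) has_sum c) {()}"
    using has_sum_finite[of "{()}" "\<lambda>_. c"] by simp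
  from has_sum_fps_Times[OF S this]
  have "((\<lambda>(x, y). F x * c) has_sum (S * c)) (I \<times> {()})" .
  also have "I \<times> {()} = (\<lambda>x. (x, ())) ` I" by auto
  finally have "((\<lambda>(x, y). F x * c) has_sum (S * c)) ((\<lambda>x. (x, ())) ` I)" .
  then show ?thesis by (subst (asm) has_sum_reindex) (auto intro: inj_onI simp: o_def)
qed

lemma fps_nth_eq_0_if_X_power_dvd:
  fixes f :: "'a::comm_ring_1 fps"
  assumes "fps_X ^ m dvd f" "n < m"
  shows "fps_nth f n = 0"
  using assms by (auto elim!: dvdE simp: fps_X_power_mult_nth)

lemma fps_X_dvd_if_nth_0:
  fixes f :: "'a::comm_ring_1 fps"
  assumes "fps_nth f 0 = 0"
  shows "fps_X dvd f"
proof -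
  have "f = fps_X * fps_shift 1 f"
    using assms by (intro fps_ext) simp
  then show ?thesis by (metis dvd_triv_left)
qed

lemma LIMSEQ_fps_if_X_power_dvd:
  fixes a :: "nat \<Rightarrow> 'a::comm_ring_1 fps"
  assumes "\<And>n. fps_X ^ Suc n dvd L - a n"
  shows "a \<longlonglongrightarrow> L"
proof (rule tendsto_fpsI)
  fix n
  show "\<forall>\<^sub>F m in sequentially. fps_nth (a m) n = fps_nth L n"
    using eventually_ge_at_top[of n]
  proof eventually_elim
    case (elim m)
    then have "fps_nth (L - a m) n = 0"
      by (intro fps_nth_eq_0_if_X_power_dvd[OF assms]) simp
    then show ?case by simp
  qed
qed

section \<open>Concatenation of paths\<close>

lemma height_Nil [simp]: "height k [] i = int k"
  by (simp add: height_def)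

lemma height_0 [simp]: "height k p 0 = int k"
  by (simp add: height_def)

lemma height_append_left: "i \<le> length p \<Longrightarrow> height k (p @ q) i = height k p i"
  by (simp add: height_def)

lemma height_append_right:
  "height k p (length p) = int m \<Longrightarrow> height k (p @ q) (length p + i) = height m q i"
  by (simp add: height_def)

lemma height_Suc: "i < length p \<Longrightarrow> height k p (Suc i) = height k p i + step_dy (p ! i)"
  by (simp add: height_def take_Suc_conv_app_nth)

lemma path_weight_Nil [simp]: "path_weight D A k [] = 1"
  by (simp add: path_weight_def)

lemma path_weight_snoc:
  "path_weight D A k (p @ [s]) =
     path_weight D A k p * step_weight D A s (nat (height k p (length p)))"
  by (simp add: path_weight_def nth_append height_append_left)

text \<open>
  Weights depend on absolute heights, so the second factor is weighted as a path that starts where the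
  first one ends.
\<close>

lemma path_weight_append:
  assumes "height k p (length p) = int m"
  shows "path_weight D A k (p @ q) = path_weight D A k p * path_weight D A m q"
proof (induction q rule: rev_induct)
  case (snoc s q)
  then show ?case
    using path_weight_snoc[of D A k "p @ q" s] height_append_right[OF assms, of q "length q"]
    by (simp add: path_weight_snoc mult.assoc)
qed simp

lemma motzkin_paths_iff:
  "k \<le> l \<Longrightarrow> p \<in> motzkin_paths k l \<longleftrightarrow>
     height k p (length p) = int l \<and> (\<forall>i\<le>length p. int k \<le> height k p i)"
  by (simp add: motzkin_paths_def min_absorb1)

section \<open>Summability of the path weights\<close>

text \<open>
  Both falls and level steps are counted: these are the steps whose weight has zero constant term.
\<close>

definition nonrise_steps :: "step list \<Rightarrow> nat" where
  "nonrise_steps p = length (filter (\<lambda>s. s \<noteq> Rise) p)"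

text \<open>
  A rise adds \<open>1\<close> to the length and to the final height, so it preserves the difference of the two
  sides; a level step adds \<open>1\<close> on the left and \<open>2\<close> on the right, and a fall adds \<open>1\<close> on both.
\<close>

lemma length_le_nonrise_steps:
  "int (length p) + int k \<le> 2 * int (nonrise_steps p) + height k p (length p)"
proof (induction p rule: rev_induct)
  case (snoc s p)
  have "height k (p @ [s]) (Suc (length p)) = height k p (length p) + step_dy s"
    by (simp add: height_def)
  with snoc show ?case by (cases s) (auto simp: nonrise_steps_def)
qed (simp add: nonrise_steps_def)

text \<open>
  The heights have to be nonnegative since a fall that starts at height \<open>0\<close> would have weight \<open>A 0\<close>,
  whose constant term may be nonzero.
\<close>

lemma X_power_dvd_path_weight:
  fixes A D :: "nat \<Rightarrow> 'a::field fps"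
  assumes A: "\<And>k. k \<ge> 1 \<Longrightarrow> fps_nth (A k) 0 = 0"
    and D: "\<And>k. k \<ge> 1 \<Longrightarrow> fps_nth (D k) 0 = 0"
    and "\<And>i. i \<le> length p \<Longrightarrow> height k p i \<ge> 0"
  shows "fps_X ^ nonrise_steps p dvd path_weight D A k p"
  using assms(3)
proof (induction p rule: rev_induct)
  case (snoc s p)
  define h where "h = height k p (length p)"
  have nonneg: "height k p i \<ge> 0" if "i \<le> length p" for i
    using snoc.prems[of i] that by (simp add: height_append_left)
  have "h + step_dy s \<ge> 0"
    using snoc.prems[of "Suc (length p)"] by (simp add: height_def h_def)
  then have "fps_X ^ nonrise_steps [s] dvd step_weight D A s (nat h)"
    using A[of "nat h"] D[of "nat h + 1"]
    by (cases s) (auto simp: nonrise_steps_def intro!: fps_X_dvd_if_nth_0)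
  moreover have "fps_X ^ nonrise_steps p dvd path_weight D A k p"
    by (rule snoc.IH) (rule nonneg)
  moreover have "nonrise_steps (p @ [s]) = nonrise_steps p + nonrise_steps [s]"
    by (simp add: nonrise_steps_def)
  ultimately show ?case
    by (simp add: path_weight_snoc power_add mult_dvd_mono h_def)
qed (simp add: nonrise_steps_def)

text \<open>
  A path whose weight has a nonzero coefficient of \<open>t\<^sup>n\<close> has at most \<open>n\<close> steps that are not rises,
  hence length at most \<open>2 n + l\<close>. There are only finitely many such paths.
\<close>

lemma path_weight_summable:
  fixes A D :: "nat \<Rightarrow> 'a::field fps"
  assumes A: "\<And>k. k \<ge> 1 \<Longrightarrow> fps_nth (A k) 0 = 0"
    and D: "\<And>k. k \<ge> 1 \<Longrightarrow> fps_nth (D k) 0 = 0"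
  shows "path_weight D A k summable_on motzkin_paths k l"
proof -
  define supp where "supp n = {p \<in> motzkin_paths k l. fps_nth (path_weight D A k p) n \<noteq> 0}" for n
  have "finite (supp n)" for n
  proof (rule finite_subset)
    show "supp n \<subseteq> {p. set p \<subseteq> UNIV \<and> length p \<le> 2 * n + l}"
    proof
      fix p assume p: "p \<in> supp n"
      then have h: "height k p (length p) = int l" "\<And>i. i \<le> length p \<Longrightarrow> height k p i \<ge> 0"
        by (force simp: supp_def motzkin_paths_def)+
      have "\<not> n < nonrise_steps p"
        using fps_nth_eq_0_if_X_power_dvd[OF X_power_dvd_path_weight[OF A D h(2)]] p
        by (auto simp: supp_def)
      then show "p \<in> {p. set p \<subseteq> UNIV \<and> length p \<le> 2 * n + l}"
        using length_le_nonrise_steps[of p k] h(1) by simp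
    qed
    have "(UNIV :: step set) = {Rise, Level, Fall}" using step.exhaust by auto
    then have "finite (UNIV :: step set)" by (metis finite.simps)
    then show "finite {p :: step list. set p \<subseteq> UNIV \<and> length p \<le> 2 * n + l}"
      by (rule finite_lists_length_le)
  qed
  then have "(path_weight D A k has_sum Abs_fps (\<lambda>n. \<Sum>p\<in>supp n. fps_nth (path_weight D A k p) n))
      (motzkin_paths k l)"
    by (intro has_sum_fpsI) (simp_all add: supp_def)
  then show ?thesis by (auto simp: summable_on_def)
qed

section \<open>Decompositions of Motzkin paths\<close>

lemma heights_around_rise:
  assumes "b \<le> m" "p \<in> motzkin_paths b m" "q \<in> motzkin_paths (Suc m) (Suc m)"
  defines "r \<equiv> p @ Rise # q"
  shows "i \<le> length p \<Longrightarrow> height b r i = height b p i"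
    and "length p < i \<Longrightarrow> height b r i = height (Suc m) q (i - Suc (length p))"
proof -
  show "i \<le> length p \<Longrightarrow> height b r i = height b p i"
    by (simp add: r_def height_append_left)
  have "height b (p @ [Rise]) (length (p @ [Rise])) = int (Suc m)"
    using assms(2) by (simp add: motzkin_paths_def height_def)
  from height_append_right[OF this, of q "i - Suc (length p)"]
  show "length p < i \<Longrightarrow> height b r i = height (Suc m) q (i - Suc (length p))"
    by (simp add: r_def)
qed

text \<open>
  The point between \<open>p\<close> and the separating rise is recovered from the whole path as its last point of
  height at most \<open>m\<close>: afterwards the path stays at height \<open>\<ge> m + 1\<close>. This gives injectivity.
  Conversely, since a step climbs by at most \<open>1\<close>, any path at level \<open>b \<rightarrow> m + 1\<close> is at height exactly
  \<open>m\<close> at that point and continues with a rise.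
\<close>

lemma last_passage_bij:
  assumes "b \<le> m"
  shows "bij_betw (\<lambda>(p, q). p @ Rise # q)
    (motzkin_paths b m \<times> motzkin_paths (Suc m) (Suc m)) (motzkin_paths b (Suc m))"
    (is "bij_betw ?f ?S ?T")
proof (rule bij_betw_imageI)
  have last: "height b (p @ Rise # q) (length p) = int m"
    "length p < i \<Longrightarrow> i \<le> length (p @ Rise # q) \<Longrightarrow> int m < height b (p @ Rise # q) i"
    if "p \<in> motzkin_paths b m" "q \<in> motzkin_paths (Suc m) (Suc m)" for p q i
  proof -
    show "height b (p @ Rise # q) (length p) = int m"
      using heights_around_rise(1)[OF assms that, of "length p"] that assms
      by (simp add: motzkin_paths_iff)
    assume i: "length p < i" "i \<le> length (p @ Rise # q)"
    then have "i - Suc (length p) \<le> length q" by simp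
    then have "int (Suc m) \<le> height (Suc m) q (i - Suc (length p))"
      using that(2) by (simp add: motzkin_paths_iff del: of_nat_Suc)
    then show "int m < height b (p @ Rise # q) i"
      using heights_around_rise(2)[OF assms that i(1)] by simp
  qed
  show "inj_on ?f ?S"
  proof (rule inj_onI, clarsimp)
    fix p q p' q'
    assume p: "p \<in> motzkin_paths b m" "q \<in> motzkin_paths (Suc m) (Suc m)"
      and p': "p' \<in> motzkin_paths b m" "q' \<in> motzkin_paths (Suc m) (Suc m)"
      and eq: "p @ Rise # q = p' @ Rise # q'"
    then have len: "length p + length q = length p' + length q'"
      by (metis add_Suc_right add_left_cancel length_Cons length_append nat.inject)
    have "\<not> length p < length p'"
      using last(2)[OF p, of "length p'"] last(1)[OF p'] len unfolding eq by auto
    moreover have "\<not> length p' < length p"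
      using last(2)[OF p', of "length p"] last(1)[OF p] len unfolding eq by auto
    ultimately have "length p = length p'" by simp
    with eq show "p = p' \<and> q = q'" by simp
  qed
  show "?f ` ?S = ?T"
  proof (intro equalityI subsetI)
    fix r assume "r \<in> ?f ` ?S"
    then obtain p q where p: "p \<in> motzkin_paths b m" "q \<in> motzkin_paths (Suc m) (Suc m)"
      and r: "r = p @ Rise # q" by auto
    have "height b r (length r) = int (Suc m)"
      using heights_around_rise(2)[OF assms p, of "length r"] p(2)
      by (simp add: r motzkin_paths_iff)
    moreover have "int b \<le> height b r i" if "i \<le> length r" for i
    proof (cases "i \<le> length p")
      case True
      then show ?thesis
        using heights_around_rise(1)[OF assms p True] p(1) assms by (simp add: r motzkin_paths_iff)
    next
      case False
      then show ?thesis using last(2)[OF p, of i] that assms by (simp add: r)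
    qed
    ultimately show "r \<in> ?T" using assms by (simp add: motzkin_paths_iff)
  next
    fix r assume "r \<in> ?T"
    then have end_r: "height b r (length r) = int m + 1"
      and low: "\<And>i. i \<le> length r \<Longrightarrow> int b \<le> height b r i"
      using assms by (simp_all add: motzkin_paths_iff)
    \<comment> \<open>The last point of height at most \<open>m\<close>; the starting point is such a point because \<open>b \<le> m\<close>.\<close>
    define low_at where "low_at i \<longleftrightarrow> i \<le> length r \<and> height b r i \<le> int m" for i
    define i where "i = Greatest low_at"
    have "low_at 0" using assms by (simp add: low_at_def)
    then have "low_at i"
      unfolding i_def by (rule GreatestI_nat[where b = "length r"]) (simp add: low_at_def)
    then have i: "i \<le> length r" "height b r i \<le> int m" by (auto simp: low_at_def)
    have above: "int m < height b r j" if "i < j" "j \<le> length r" for j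
      using Greatest_le_nat[of low_at j "length r"] that by (force simp: i_def low_at_def)
    have "i < length r" using i end_r by (cases "i = length r") auto
    moreover from this have "int m < height b r i + step_dy (r ! i)"
      using above[of "Suc i"] by (simp add: height_Suc)
    ultimately have rise: "r ! i = Rise" and at_i: "height b r i = int m"
      using i by (cases "r ! i"; simp)+
    define p q where "p = take i r" and "q = drop (Suc i) r"
    have r: "r = p @ Rise # q"
      using id_take_nth_drop[OF \<open>i < length r\<close>] rise by (simp add: p_def q_def)
    have len: "length p = i"
      using \<open>i < length r\<close> by (simp add: p_def)
    have hp: "height b p j = height b r j" if "j \<le> i" for j
      using that by (simp add: r height_append_left len)
    have p: "p \<in> motzkin_paths b m"
      using low i(1) at_i assms by (auto simp: motzkin_paths_iff hp len)
    have "height b (p @ [Rise]) (length (p @ [Rise])) = int (Suc m)"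
      using p by (simp add: motzkin_paths_def height_def)
    from height_append_right[OF this]
    have hq: "height (Suc m) q j = height b r (Suc i + j)" for j
      by (simp add: r len)
    have "int (Suc m) \<le> height (Suc m) q j" if "j \<le> length q" for j
      using above[of "Suc i + j"] that by (simp add: hq) (simp add: r len)
    then have "q \<in> motzkin_paths (Suc m) (Suc m)"
      using end_r by (simp add: motzkin_paths_iff hq) (simp add: r len)
    with p show "r \<in> ?f ` ?S" using r by force
  qed
qed

lemma motzkin_paths_snoc:
  assumes "k \<le> l"
  shows "p @ [s] \<in> motzkin_paths k l \<longleftrightarrow>
    height k p (length p) + step_dy s = int l \<and> (\<forall>i\<le>length p. int k \<le> height k p i)"
proof -
  have "height k (p @ [s]) (Suc (length p)) = height k p (length p) + step_dy s"
    by (simp add: height_def)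
  then show ?thesis
    using assms by (auto simp: motzkin_paths_iff le_Suc_eq height_append_left)
qed

text \<open>
  The last step cannot be a rise, as it would start at height \<open>k - 1\<close>.
\<close>

lemma motzkin_paths_last_step:
  "motzkin_paths k k = {[]} \<union> (\<lambda>p. p @ [Level]) ` motzkin_paths k k
     \<union> (\<lambda>p. p @ [Fall]) ` motzkin_paths k (Suc k)" (is "_ = ?R")
proof (rule set_eqI)
  fix p
  show "p \<in> motzkin_paths k k \<longleftrightarrow> p \<in> ?R"
  proof (cases p rule: rev_cases)
    case Nil
    then show ?thesis by (simp add: motzkin_paths_iff)
  next
    case (snoc q s)
    then show ?thesis
      using motzkin_paths_snoc[of k k q s] motzkin_paths_iff[of k k q]
        motzkin_paths_iff[of k "Suc k" q]
      by (cases s) auto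
  qed
qed

section \<open>Recurrences for the generating functions\<close>

context
  fixes A D :: "nat \<Rightarrow> 'a::field fps"
  assumes A: "\<And>k. k \<ge> 1 \<Longrightarrow> fps_nth (A k) 0 = 0"
    and D: "\<And>k. k \<ge> 1 \<Longrightarrow> fps_nth (D k) 0 = 0"
begin

lemma motzkin_gf_has_sum: "(path_weight D A k has_sum motzkin_gf D A k l) (motzkin_paths k l)"
  unfolding motzkin_gf_def by (intro has_sum_infsum path_weight_summable A D)

lemma motzkin_gf_Suc:
  assumes "b \<le> m"
  shows "motzkin_gf D A b (Suc m) = motzkin_gf D A b m * motzkin_gf D A (Suc m) (Suc m)"
proof -
  let ?S = "motzkin_paths b m \<times> motzkin_paths (Suc m) (Suc m)"
  have weight: "path_weight D A b (p @ Rise # q) = path_weight D A b p * path_weight D A (Suc m) q"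
    if "p \<in> motzkin_paths b m" for p q
  proof -
    have "height b (p @ [Rise]) (length (p @ [Rise])) = int (Suc m)"
      using that by (simp add: motzkin_paths_def height_def)
    from path_weight_append[OF this, of D A q] show ?thesis
      by (simp add: path_weight_snoc)
  qed
  have "motzkin_gf D A b (Suc m) = (\<Sum>\<^sub>\<infinity>z\<in>?S. path_weight D A b (case z of (p, q) \<Rightarrow> p @ Rise # q))"
    unfolding motzkin_gf_def by (rule infsum_reindex_bij_betw[symmetric, OF last_passage_bij[OF assms]])
  also have "\<dots> = (\<Sum>\<^sub>\<infinity>(p, q)\<in>?S. path_weight D A b p * path_weight D A (Suc m) q)"
    by (rule infsum_cong) (auto simp: weight)
  also have "\<dots> = motzkin_gf D A b m * motzkin_gf D A (Suc m) (Suc m)"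
    by (intro infsumI has_sum_fps_Times motzkin_gf_has_sum)
  finally show ?thesis .
qed

lemma has_sum_snoc:
  assumes "k \<le> l"
  shows "(path_weight D A k has_sum motzkin_gf D A k l * step_weight D A s l)
    ((\<lambda>p. p @ [s]) ` motzkin_paths k l)"
proof -
  have "((\<lambda>p. path_weight D A k p * step_weight D A s l) has_sum
      motzkin_gf D A k l * step_weight D A s l) (motzkin_paths k l)"
    by (intro has_sum_fps_mult_right motzkin_gf_has_sum)
  also have "?this \<longleftrightarrow> ((path_weight D A k \<circ> (\<lambda>p. p @ [s])) has_sum
      motzkin_gf D A k l * step_weight D A s l) (motzkin_paths k l)"
    by (rule has_sum_cong) (auto simp: path_weight_snoc motzkin_paths_def)
  finally show ?thesis by (subst has_sum_reindex) (auto intro: inj_onI)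
qed

lemma motzkin_gf_last_step:
  "motzkin_gf D A k k = 1 + motzkin_gf D A k k * D (Suc k) + motzkin_gf D A k (Suc k) * A (Suc k)"
proof -
  have nil: "(path_weight D A k has_sum 1) {[]}"
    using has_sum_finite[of "{[]}" "path_weight D A k"] by simp
  have "(path_weight D A k has_sum
      1 + motzkin_gf D A k k * D (Suc k) + motzkin_gf D A k (Suc k) * A (Suc k)) (motzkin_paths k k)"
    using has_sum_snoc[of k k Level] has_sum_snoc[of k "Suc k" Fall]
    by (subst motzkin_paths_last_step, intro has_sum_fps_Un_disjoint nil) auto
  then show ?thesis
    using motzkin_gf_has_sum infsumI motzkin_gf_def by metis
qed

text \<open>
  Last passage turns the paths at level \<open>k \<rightarrow> k + 1\<close> in the last-step recurrence into the product of
  two diagonal generating functions.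
\<close>

lemma motzkin_gf_continued_fraction_step:
  "motzkin_gf D A k k * (1 - D (Suc k) - A (Suc k) * motzkin_gf D A (Suc k) (Suc k)) = 1"
  using motzkin_gf_last_step[of k] motzkin_gf_Suc[of k k] by (simp add: algebra_simps)

lemma cf_denom_nth_0: "fps_nth (cf_denom D A n k) 0 = 1"
proof (induction n arbitrary: k)
  case 0
  then show ?case using D[of "Suc k"] by simp
next
  case (Suc n)
  then show ?case using D[of "Suc k"] A[of "Suc k"] by (simp add: fps_divide_unit)
qed

text \<open>
  If \<open>M e = 1\<close>, then \<open>M - 1 / d = (M / d) (d - e)\<close>, so approximating the inverse \<open>e\<close> of a generating
  function is as good as approximating the generating function itself. When \<open>d\<close> is
  the truncated denominator of depth \<open>n + 1\<close> at level \<open>k\<close>, the difference \<open>d - e\<close> is \<open>A\<^bsub>k+1\<^esub>\<close> times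
  the error of depth \<open>n\<close> at level \<open>k + 1\<close>, so it gains a factor \<open>t\<close>.
\<close>

lemma X_power_dvd_motzkin_gf_minus_convergent:
  "fps_X ^ Suc n dvd motzkin_gf D A k k - inverse (cf_denom D A n k)"
proof -
  have reduce: "fps_X ^ Suc n dvd motzkin_gf D A k k - inverse d"
    if d: "fps_nth d 0 = 1"
      and dvd: "fps_X ^ Suc n dvd d - (1 - D (Suc k) - A (Suc k) * motzkin_gf D A (Suc k) (Suc k))"
    for n k d
  proof -
    define e where "e = 1 - D (Suc k) - A (Suc k) * motzkin_gf D A (Suc k) (Suc k)"
    have "d * inverse d = 1" using d by (simp add: inverse_mult_eq_1')
    moreover have "motzkin_gf D A k k * e = 1"
      unfolding e_def by (rule motzkin_gf_continued_fraction_step)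
    moreover have "motzkin_gf D A k k * inverse d * (d - e) =
        motzkin_gf D A k k * (d * inverse d) - motzkin_gf D A k k * e * inverse d"
      by (simp add: algebra_simps)
    ultimately have "motzkin_gf D A k k - inverse d = motzkin_gf D A k k * inverse d * (d - e)"
      by simp
    then show ?thesis using dvd by (simp add: e_def)
  qed
  have A_dvd: "fps_X dvd A (Suc k)" for k
    using A by (simp add: fps_X_dvd_if_nth_0)
  show ?thesis
  proof (induction n arbitrary: k)
    case 0
    \<comment> \<open>Here \<open>d - e = A (Suc k) * motzkin_gf D A (Suc k) (Suc k)\<close>, since the truncation drops this term.\<close>
    show ?case
      by (rule reduce[OF cf_denom_nth_0]) (use A_dvd in auto)
  next
    case (Suc n)
    have "fps_X * fps_X ^ Suc n dvd
        A (Suc k) * (motzkin_gf D A (Suc k) (Suc k) - inverse (cf_denom D A n (Suc k)))"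
      by (intro mult_dvd_mono A_dvd Suc.IH)
    also have "\<dots> = cf_denom D A (Suc n) k
        - (1 - D (Suc k) - A (Suc k) * motzkin_gf D A (Suc k) (Suc k))"
      by (simp add: fps_divide_unit cf_denom_nth_0 algebra_simps)
    finally show ?case
      by (intro reduce cf_denom_nth_0) simp
  qed
qed

lemma cf_tendsto: "(\<lambda>n. c / cf_denom D A n k) \<longlonglongrightarrow> c * motzkin_gf D A k k"
proof (rule LIMSEQ_fps_if_X_power_dvd)
  fix n
  have "c * motzkin_gf D A k k - c / cf_denom D A n k =
      c * (motzkin_gf D A k k - inverse (cf_denom D A n k))"
    by (simp add: fps_divide_unit cf_denom_nth_0 algebra_simps)
  then show "fps_X ^ Suc n dvd c * motzkin_gf D A k k - c / cf_denom D A n k"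
    using X_power_dvd_motzkin_gf_minus_convergent[of n k] by (metis dvd_mult)
qed

lemma motzkin_gf_0_eq_prod: "motzkin_gf D A 0 k = (\<Prod>i=0..k. motzkin_gf D A i i)"
  by (induction k) (simp_all add: motzkin_gf_Suc)

end

theorem proposition8p3:
  fixes A D :: "nat \<Rightarrow> 'a::field fps"
    and f :: "'a fps" and f_tail g :: "nat \<Rightarrow> 'a fps" and g_init :: "'a fps"
  assumes A0: "fps_nth (A 0) 0 \<noteq> 0"
    and A: "\<And>k. k \<ge> 1 \<Longrightarrow> fps_nth (A k) 0 = 0"
    and D: "\<And>k. k \<ge> 1 \<Longrightarrow> fps_nth (D k) 0 = 0"
    and f: "f = cf_full D A"
    and f_tail: "\<And>k. f_tail k = cf_tail D A k"
    and g_init: "fps_nth g_init 0 = 1"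
    and g: "\<And>k. g k = g_init * (\<Prod>i=0..k. f_tail i)"
  shows "convergent (\<lambda>n. A 0 / cf_denom D A n 0)
    \<and> (\<forall>k. convergent (\<lambda>n. 1 / cf_denom D A n k))
    \<and> (\<forall>k l. path_weight D A k summable_on motzkin_paths k l)
    \<and> f = A 0 * motzkin_gf D A 0 0
    \<and> (\<forall>k. f_tail k = motzkin_gf D A k k)
    \<and> (\<forall>k. g k = g_init * motzkin_gf D A 0 k)"
proof -
  have lim: "(\<lambda>n. c / cf_denom D A n k) \<longlonglongrightarrow> c * motzkin_gf D A k k" for c k
    by (rule cf_tendsto) (fact A, fact D)
  have tail: "f_tail k = motzkin_gf D A k k" for k
    using lim[where c = 1 and k = k] by (simp add: f_tail cf_tail_def limI)
  have "convergent (\<lambda>n. A 0 / cf_denom D A n 0)"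
    using lim by (auto simp: convergent_def)
  moreover have "convergent (\<lambda>n. 1 / cf_denom D A n k)" for k
    using lim by (auto simp: convergent_def)
  moreover have "path_weight D A k summable_on motzkin_paths k l" for k l
    by (rule path_weight_summable) (fact A, fact D)
  moreover have "f = A 0 * motzkin_gf D A 0 0"
    unfolding f cf_full_def by (rule limI[OF lim])
  moreover have "g k = g_init * motzkin_gf D A 0 k" for k
    using motzkin_gf_0_eq_prod[of A D k] A D by (simp add: g tail)
  ultimately show ?thesis using tail by blast
qed

end
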